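(* Let $\alpha \in (0,1)$ and $\beta > \alpha$. Suppose that there exist $c >0$, $C<\infty$, and $x_0 < \infty$ for which, for all $t \in \mathbb{Z}^+$, $$\mathbb{E} [ (\Delta_t^-)^\beta \mid \mathcal{F}_t ] \leq C \quad \text{a.s.},$$ and, for all $x \geq x_0$ and all $t \in \mathbb{Z}^+$, $$\mathbb{E} [ \Delta_t^+ \mathbf{1} \{ \Delta_t^+ \leq x \} \mid \mathcal{F}_t ] \geq c x^{1-\alpha} \quad \text{a.s.}$$ Then for any $x \in \mathbb{R}$ and any $p \in [0, \beta/\alpha )$, $\mathbb{E} [ \tau_x^{p} ] < \infty$.
   Context: $\mathbb{Z}^+ = \{0,1,2,\ldots\}$. $(X_t)_{t \in \mathbb{Z}^+}$ is a real-valued stochastic process adapted to a filtration $(\mathcal{F}_t)_{t \in \mathbb{Z}^+}$, with $X_0 = 0$ (no Markov property is assumed). Its increments are $\Delta_t := X_{t+1} - X_t$. For real $x$, $x^+ := x \mathbf{1}\{x>0\}$ and $x^- := -x\mathbf{1}\{x<0\}$; $\Delta_t^\pm := (\Delta_t)^\pm$. For $x \in \mathbb{R}$, $\tau_x := \min \{ t \in \mathbb{Z}^+ : X_t \geq x \}$ is the first passage time into $[x,\infty)$, with $\min \emptyset := \infty$. The constants $c, C, x_0$ are non-random and do not depend on $t$; $x_0$ is understood to be positive so that powers of $x \geq x_0$ are defined. *)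

theory Defs
  imports "HOL-Probability.Probability"
begin

definition pos_part :: "real \<Rightarrow> real" where
  "pos_part x = (if x > 0 then x else 0)"

definition neg_part :: "real \<Rightarrow> real" where
  "neg_part x = (if x < 0 then - x else 0)"

definition increment :: "(nat \<Rightarrow> 'a \<Rightarrow> real) \<Rightarrow> nat \<Rightarrow> 'a \<Rightarrow> real" where
  "increment X t \<omega> = X (Suc t) \<omega> - X t \<omega>"

definition adapted_process :: "'a measure \<Rightarrow> (nat \<Rightarrow> 'a measure) \<Rightarrow> (nat \<Rightarrow> 'a \<Rightarrow> real) \<Rightarrow> bool" where
  "adapted_process M F X \<longleftrightarrow>
     filtration (space M) F \<and> (\<forall>t. subalgebra M (F t)) \<and> (\<forall>t. X t \<in> borel_measurable (F t))"

definition first_passage :: "(nat \<Rightarrow> 'a \<Rightarrow> real) \<Rightarrow> real \<Rightarrow> 'a \<Rightarrow> enat" where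
  "first_passage X x \<omega> =
     (if \<exists>t. X t \<omega> \<ge> x then enat (LEAST t. X t \<omega> \<ge> x) else \<infinity>)"

text \<open>Real powers of extended natural numbers, for exponents p \<open>\<ge>\<close> 0. Every zeroth power is 1,
  including that of 0 (where \<open>powr\<close> gives 0) and of \<open>\<infinity>\<close>; for p > 0 the value at \<open>\<infinity>\<close> is \<open>\<infinity>\<close>.\<close>

definition enat_powr :: "enat \<Rightarrow> real \<Rightarrow> ennreal" where
  "enat_powr n p =
     (if p = 0 then 1 else case n of enat k \<Rightarrow> ennreal (real k powr p) | \<infinity> \<Rightarrow> \<infinity>)"

end

theory Submission
  imports Defs "HOL-Real_Asymp.Real_Asymp"
begin

text \<open>Write \<open>q = \<beta> / \<alpha> > 1\<close>. The idea is a Lyapunov function that depends on time. Let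
  \<open>Z t = max 0 (x + A - X t)\<close> be the distance to a level slightly beyond the target, and let
  \<open>U t = (Z t powr \<alpha> + \<rho> * t) powr q\<close>. For a small rate \<open>\<rho>\<close> and a large margin \<open>A\<close>, \<open>U\<close> is a
  supermartingale up to the first passage time \<open>\<tau>\<close> of \<open>x\<close>. Since \<open>U t \<ge> (\<rho> * t) powr q\<close> always, this
  bounds the \<open>q\<close>-th moments of \<open>min \<tau> n\<close> uniformly in \<open>n\<close>, and Fatou's lemma gives a finite \<open>q\<close>-th
  moment of \<open>\<tau>\<close>. So even the critical exponent \<open>p = \<beta> / \<alpha>\<close> is attained, and smaller exponents follow.

  Why \<open>U\<close> is a supermartingale: put \<open>T = Z powr \<alpha> + \<rho> * t\<close>. An upward jump of size \<open>u \<le> Z\<close> lowers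
  \<open>Z powr \<alpha>\<close> by at least \<open>\<alpha> * u * Z powr (\<alpha> - 1)\<close>, because the power is concave. The mean of
  these jumps is at least \<open>c * Z powr (1 - \<alpha>)\<close>, so the two powers of \<open>Z\<close> cancel and \<open>Z powr \<alpha>\<close> drops at
  a constant rate; \<open>U\<close> drops at a rate of order \<open>T powr (q - 1)\<close>. The passage of time
  contributes \<open>\<rho> * T powr (q - 1)\<close> up to a constant. A downward jump of size \<open>D\<close> raises
  \<open>Z powr \<alpha>\<close> by some \<open>h\<close> and hence \<open>U\<close> by at most a constant times \<open>h * T powr (q - 1) + h powr q\<close>.
  Here \<open>h \<le> D powr \<delta> * Z powr (\<alpha> - \<delta>)\<close> with \<open>\<delta> = min \<beta> 1 > \<alpha>\<close>, which has small mean when \<open>Z\<close> is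
  large, and \<open>h powr q \<le> D powr \<beta>\<close>, whose bounded mean is negligible against \<open>T powr (q - 1)\<close>. The
  pointwise form of this computation is \<open>lyapunov_step_uniform\<close>; it is integrated against the
  conditional moment hypotheses in \<open>lyapunov_integral_step\<close>, and \<open>first_passage_moment_finite\<close> turns
  the supermartingale inequality into a moment bound.\<close>

section \<open>Inequalities for real powers\<close>

text \<open>A concave power lies below its tangent at \<open>a\<close>; this is Young's inequality with weights \<open>\<theta>\<close> and
  \<open>1 - \<theta>\<close>, divided by \<open>a powr (1 - \<theta>)\<close>.\<close>
lemma powr_tangent_le:
  fixes a b \<theta> :: real
  assumes "0 < \<theta>" "\<theta> < 1" "0 < a" "0 \<le> b"
  shows "b powr \<theta> \<le> a powr \<theta> + \<theta> * a powr (\<theta> - 1) * (b - a)"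
proof (cases "b = 0")
  case True
  have "\<theta> * a powr \<theta> \<le> 1 * a powr \<theta>"
    using assms by (intro mult_right_mono) auto
  moreover have "a powr \<theta> = a powr (\<theta> - 1) * a"
    using assms powr_mult_base[of a "\<theta> - 1"] by (simp add: mult.commute)
  ultimately show ?thesis using True assms by (simp add: algebra_simps)
next
  case False
  with assms have b: "0 < b" by simp
  have "b powr \<theta> * a powr (1 - \<theta>) \<le> \<theta> * b + (1 - \<theta>) * a"
    using assms b by (intro Youngs_inequality_0) auto
  then have "(b powr \<theta> * a powr (1 - \<theta>)) * a powr (\<theta> - 1)
      \<le> (\<theta> * b + (1 - \<theta>) * a) * a powr (\<theta> - 1)"
    by (intro mult_right_mono) auto
  moreover have "a powr (1 - \<theta>) * a powr (\<theta> - 1) = 1"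
    using assms by (simp flip: powr_add)
  moreover have "a powr \<theta> = a powr (\<theta> - 1) * a"
    using assms powr_mult_base[of a "\<theta> - 1"] by (simp add: mult.commute)
  ultimately show ?thesis by (simp add: algebra_simps)
qed

text \<open>The tangent bound for a convex power, again by Young's inequality, with weights \<open>1/q\<close> and \<open>1 - 1/q\<close>.\<close>
lemma powr_diff_le:
  fixes a b q :: real
  assumes "1 < q" "0 < a" "a \<le> b"
  shows "b powr q - a powr q \<le> q * (b - a) * b powr (q - 1)"
proof -
  have "(a powr q) powr (1/q) * (b powr q) powr (1 - 1/q) \<le> (1/q) * a powr q + (1 - 1/q) * b powr q"
    using assms by (intro Youngs_inequality_0) auto
  moreover have "(a powr q) powr (1/q) = a" "(b powr q) powr (1 - 1/q) = b powr (q - 1)"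
    using assms by (simp_all add: powr_powr right_diff_distrib)
  ultimately have "q * (a * b powr (q - 1)) \<le> q * ((1/q) * a powr q + (1 - 1/q) * b powr q)"
    using assms by (intro mult_left_mono) auto
  also have "\<dots> = a powr q + (q - 1) * b powr q"
    using assms by (simp add: field_simps)
  finally have "q * (a * b powr (q - 1)) \<le> a powr q + (q - 1) * b powr q" .
  moreover have "b powr q = b * b powr (q - 1)"
    using assms by (simp add: powr_mult_base)
  ultimately show ?thesis by (simp add: algebra_simps)
qed

text \<open>A lower bound with the derivative at the larger endpoint, so that a decrease of the base by \<open>b - a\<close>
  pays in full at the old value \<open>b\<close>, without second-order loss.\<close>
lemma powr_diff_ge:
  fixes a b q :: real
  assumes "1 \<le> q" "0 \<le> a" "a \<le> b"
  shows "(b - a) * b powr (q - 1) \<le> b powr q - a powr q"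
proof -
  have "a * a powr (q - 1) \<le> a * b powr (q - 1)"
    using assms by (intro mult_left_mono powr_mono2) auto
  then show ?thesis using assms by (simp add: powr_mult_base left_diff_distrib)
qed

lemma powr_subadditive:
  fixes a b \<theta> :: real
  assumes "\<theta> \<le> 1" "0 < a" "0 < b"
  shows "(a + b) powr \<theta> \<le> a powr \<theta> + b powr \<theta>"
proof -
  have "a * (a + b) powr (\<theta> - 1) \<le> a * a powr (\<theta> - 1)"
       "b * (a + b) powr (\<theta> - 1) \<le> b * b powr (\<theta> - 1)"
    using assms by (auto intro!: mult_left_mono powr_mono2')
  then show ?thesis
    using assms powr_mult_base[of "a + b" "\<theta> - 1"] by (simp add: powr_mult_base algebra_simps)
qed

text \<open>Interpolation between the tangent bound, which is the better one for \<open>d \<le> z\<close>, and subadditivity,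
  which is the better one for \<open>d > z\<close>. Taking \<open>\<delta> > \<alpha>\<close> produces a negative power of \<open>z\<close>, which makes the
  effect of a jump small when the process is far from its target.\<close>
lemma powr_increment_interpolate:
  fixes z d \<alpha> \<delta> :: real
  assumes "0 < \<alpha>" "\<alpha> < 1" "\<alpha> \<le> \<delta>" "\<delta> \<le> 1" "0 < z" "0 < d"
  shows "(z + d) powr \<alpha> - z powr \<alpha> \<le> d powr \<delta> * z powr (\<alpha> - \<delta>)"
proof (cases "d \<le> z")
  case True
  have "(z + d) powr \<alpha> - z powr \<alpha> \<le> \<alpha> * (z powr (\<alpha> - 1) * d)"
    using powr_tangent_le[of \<alpha> z "z + d"] assms by simp
  also have "\<dots> \<le> 1 * (z powr (\<alpha> - 1) * d)"
    using assms by (intro mult_right_mono) auto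
  also have "\<dots> = d powr \<delta> * (d powr (1 - \<delta>) * z powr (\<alpha> - 1))"
    using assms powr_add[of d \<delta> "1 - \<delta>"] by simp
  also have "\<dots> \<le> d powr \<delta> * (z powr (1 - \<delta>) * z powr (\<alpha> - 1))"
    using assms True by (intro mult_left_mono mult_right_mono powr_mono2) auto
  also have "z powr (1 - \<delta>) * z powr (\<alpha> - 1) = z powr (\<alpha> - \<delta>)"
    using assms by (simp flip: powr_add)
  finally show ?thesis .
next
  case False
  have "(z + d) powr \<alpha> - z powr \<alpha> \<le> d powr \<alpha>"
    using powr_subadditive[of \<alpha> z d] assms by simp
  also have "\<dots> = d powr \<delta> * d powr (\<alpha> - \<delta>)"
    using assms by (simp flip: powr_add)
  also have "\<dots> \<le> d powr \<delta> * z powr (\<alpha> - \<delta>)"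
    using assms False by (intro mult_left_mono powr_mono2') auto
  finally show ?thesis .
qed

section \<open>One step of the Lyapunov function\<close>

text \<open>Effect of the time increment \<open>\<kappa>\<close> and of a jump \<open>h\<close> on a convex power. The jump may exceed \<open>T\<close>,
  whence the extra term \<open>h powr q\<close>; the factor 3 comes from \<open>T + \<kappa> + h \<le> 3 * max T h\<close>.\<close>
lemma powr_step_le:
  fixes T \<kappa> h q :: real
  assumes "1 < q" "0 < T" "0 \<le> h" "0 \<le> \<kappa>" "\<kappa> \<le> T"
  shows "(T + \<kappa> + h) powr q
    \<le> T powr q + q * 3 powr (q - 1) * (\<kappa> * T powr (q - 1) + h * T powr (q - 1) + h powr q)"
proof -
  define K where "K = q * 3 powr (q - 1)"
  have "(T + \<kappa>) powr q - T powr q \<le> q * \<kappa> * (T + \<kappa>) powr (q - 1)"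
    using powr_diff_le[of q T "T + \<kappa>"] assms by simp
  also have "\<dots> \<le> q * \<kappa> * (3 * T) powr (q - 1)"
    using assms by (intro mult_left_mono powr_mono2) auto
  also have "\<dots> = K * (\<kappa> * T powr (q - 1))"
    using assms by (simp add: K_def powr_mult)
  finally have time: "(T + \<kappa>) powr q - T powr q \<le> K * (\<kappa> * T powr (q - 1))" .
  define m where "m = max T h"
  have m: "m powr (q - 1) \<le> T powr (q - 1) + h powr (q - 1)"
    by (auto simp: m_def max_def)
  have "(T + \<kappa> + h) powr q - (T + \<kappa>) powr q \<le> q * h * (T + \<kappa> + h) powr (q - 1)"
    using powr_diff_le[of q "T + \<kappa>" "T + \<kappa> + h"] assms by simp
  also have "\<dots> \<le> q * h * (3 * m) powr (q - 1)"
    using assms by (intro mult_left_mono powr_mono2) (auto simp: m_def)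
  also have "\<dots> = K * h * m powr (q - 1)"
    using assms by (simp add: K_def powr_mult m_def)
  also have "\<dots> \<le> K * h * (T powr (q - 1) + h powr (q - 1))"
    using assms m by (intro mult_left_mono) (auto simp: K_def)
  also have "\<dots> = K * (h * T powr (q - 1) + h powr q)"
    using assms by (simp add: distrib_left mult.assoc powr_mult_base)
  finally show ?thesis
    using time unfolding K_def[symmetric] by (simp add: algebra_simps)
qed

text \<open>The pointwise inequality behind the supermartingale property. The term with \<open>pos_part d\<close> on the left
  is the gain from an upward jump. An overshooting jump sends the distance to 0 and does no harm,
  so its gain is simply discarded, which matches the truncation in the moment hypothesis.\<close>
lemma lyapunov_step:
  fixes \<alpha> q \<kappa> \<delta> z s d :: real
  assumes "0 < \<alpha>" "\<alpha> < 1" "1 < q" "\<alpha> \<le> \<delta>" "\<delta> \<le> 1"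
    and "1 \<le> z" "0 \<le> s" "0 \<le> \<kappa>" "\<kappa> \<le> 1"
  defines "T \<equiv> z powr \<alpha> + s"
  shows "(max 0 (z - d) powr \<alpha> + s + \<kappa>) powr q
        + \<alpha> * z powr (\<alpha> - 1) * T powr (q - 1) * (pos_part d * of_bool (pos_part d \<le> z))
      \<le> T powr q + q * 3 powr (q - 1) * (\<kappa> * T powr (q - 1)
          + neg_part d powr \<delta> * z powr (\<alpha> - \<delta>) * T powr (q - 1) + neg_part d powr (\<alpha> * q))"
proof -
  have T: "1 \<le> T"
    using assms by (simp add: T_def add_increasing2 ge_one_powr_ge_zero)
  show ?thesis
  proof (cases "d < 0")
    case True
    define h where "h = (z - d) powr \<alpha> - z powr \<alpha>"
    have h0: "0 \<le> h" using True assms by (simp add: h_def powr_mono2)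
    have h1: "h \<le> (- d) powr \<delta> * z powr (\<alpha> - \<delta>)"
      using powr_increment_interpolate[of \<alpha> \<delta> z "- d"] True assms by (simp add: h_def)
    have "h \<le> (- d) powr \<alpha>"
      using powr_subadditive[of \<alpha> z "- d"] True assms by (simp add: h_def)
    then have "h powr q \<le> ((- d) powr \<alpha>) powr q"
      using h0 assms by (intro powr_mono2) auto
    then have h2: "h powr q \<le> (- d) powr (\<alpha> * q)" by (simp add: powr_powr)
    have "(T + \<kappa> + h) powr q
      \<le> T powr q + q * 3 powr (q - 1) * (\<kappa> * T powr (q - 1) + h * T powr (q - 1) + h powr q)"
      using assms T h0 by (intro powr_step_le) auto
    also have "\<dots> \<le> T powr q + q * 3 powr (q - 1) * (\<kappa> * T powr (q - 1)
          + (- d) powr \<delta> * z powr (\<alpha> - \<delta>) * T powr (q - 1) + (- d) powr (\<alpha> * q))"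
      using assms h1 h2 by (intro add_left_mono mult_left_mono add_mono mult_right_mono) auto
    also have "T + \<kappa> + h = max 0 (z - d) powr \<alpha> + s + \<kappa>"
      using True assms by (simp add: T_def h_def max_def)
    finally show ?thesis using True by (simp add: pos_part_def neg_part_def)
  next
    case False
    define w where "w = max 0 (z - d) powr \<alpha>"
    have w: "0 \<le> w" "w \<le> z powr \<alpha>"
      using False assms by (auto simp: w_def intro!: powr_mono2)
    have drop: "\<alpha> * z powr (\<alpha> - 1) * (pos_part d * of_bool (pos_part d \<le> z)) \<le> z powr \<alpha> - w"
    proof (cases "d \<le> z")
      case True
      then show ?thesis
        using powr_tangent_le[of \<alpha> z "z - d"] False assms
        by (auto simp: w_def pos_part_def max_def)
    qed (use w in \<open>auto simp: pos_part_def\<close>)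
    have "\<alpha> * z powr (\<alpha> - 1) * (pos_part d * of_bool (pos_part d \<le> z)) * T powr (q - 1)
        \<le> (z powr \<alpha> - w) * (T + \<kappa>) powr (q - 1)"
      using drop w T assms by (intro mult_mono powr_mono2) auto
    also have "\<dots> \<le> (T + \<kappa>) powr q - (w + s + \<kappa>) powr q"
      using powr_diff_ge[of q "w + s + \<kappa>" "T + \<kappa>"] w assms by (simp add: T_def)
    finally have "(w + s + \<kappa>) powr q
        + \<alpha> * z powr (\<alpha> - 1) * T powr (q - 1) * (pos_part d * of_bool (pos_part d \<le> z))
      \<le> (T + \<kappa>) powr q" by (simp add: mult_ac)
    also have "\<dots> \<le> T powr q + q * 3 powr (q - 1) * (\<kappa> * T powr (q - 1))"
      using powr_step_le[of q T 0 \<kappa>] assms T by simp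
    finally show ?thesis using False assms by (simp add: neg_part_def w_def)
  qed
qed

text \<open>Once \<open>z\<close> is beyond a suitable \<open>A\<close>, all losses share the factor \<open>\<rho> * T powr (q - 1)\<close>. The jump terms
  \<open>D powr \<delta>\<close> and \<open>D powr (\<alpha> * q)\<close> are both controlled by the single quantity \<open>1 + D powr (\<alpha> * q)\<close>, whose
  conditional mean is what the hypothesis bounds.\<close>
lemma lyapunov_step_uniform:
  fixes \<alpha> q \<rho> \<delta> A z s d :: real
  assumes "0 < \<alpha>" "\<alpha> < 1" "1 < q" "\<alpha> \<le> \<delta>" "\<delta> \<le> 1" "\<delta> \<le> \<alpha> * q"
    and "1 \<le> A" "A \<le> z" "0 \<le> s" "0 \<le> \<rho>" "\<rho> \<le> 1"
    and A1: "A powr (\<alpha> - \<delta>) \<le> \<rho>" and A2: "A powr (- (\<alpha> * (q - 1))) \<le> \<rho>"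
  defines "T \<equiv> z powr \<alpha> + s"
  shows "(max 0 (z - d) powr \<alpha> + s + \<rho>) powr q
        + \<alpha> * z powr (\<alpha> - 1) * T powr (q - 1) * (pos_part d * of_bool (pos_part d \<le> z))
      \<le> T powr q + 2 * q * 3 powr (q - 1) * \<rho> * (T powr (q - 1) * (1 + neg_part d powr (\<alpha> * q)))"
proof -
  define D where "D = neg_part d"
  have D: "0 \<le> D" by (simp add: D_def neg_part_def)
  have "z powr (\<alpha> - \<delta>) \<le> A powr (\<alpha> - \<delta>)"
    using assms by (intro powr_mono2') auto
  then have z: "z powr (\<alpha> - \<delta>) \<le> \<rho>" using A1 by simp
  have "D powr \<delta> \<le> 1 + D powr (\<alpha> * q)"
  proof (cases "D \<le> 1")
    case True
    then have "D powr \<delta> \<le> 1" using D assms by (intro powr_le1) auto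
    then show ?thesis by (simp add: add_increasing2)
  next
    case False
    then have "D powr \<delta> \<le> D powr (\<alpha> * q)" using assms by (intro powr_mono) auto
    then show ?thesis by simp
  qed
  then have small_jumps: "D powr \<delta> * z powr (\<alpha> - \<delta>) \<le> (1 + D powr (\<alpha> * q)) * \<rho>"
    using z assms by (intro mult_mono) auto
  have "A powr \<alpha> \<le> z powr \<alpha>"
    using assms by (intro powr_mono2) auto
  then have "(A powr \<alpha>) powr (q - 1) \<le> T powr (q - 1)"
    using assms by (intro powr_mono2) (auto simp: T_def)
  then have "A powr (- (\<alpha> * (q - 1))) * A powr (\<alpha> * (q - 1)) \<le> \<rho> * T powr (q - 1)"
    using A2 assms by (intro mult_mono) (auto simp: powr_powr)
  then have "1 \<le> \<rho> * T powr (q - 1)"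
    using assms by (simp flip: powr_add)
  then have large_jumps: "D powr (\<alpha> * q) * 1 \<le> D powr (\<alpha> * q) * (\<rho> * T powr (q - 1))"
    by (intro mult_left_mono) auto
  have "\<rho> * T powr (q - 1) + D powr \<delta> * z powr (\<alpha> - \<delta>) * T powr (q - 1) + D powr (\<alpha> * q)
      \<le> \<rho> * T powr (q - 1) + (1 + D powr (\<alpha> * q)) * \<rho> * T powr (q - 1)
         + D powr (\<alpha> * q) * (\<rho> * T powr (q - 1))"
    using small_jumps large_jumps by (intro add_mono mult_right_mono) auto
  also have "\<dots> = 2 * \<rho> * (T powr (q - 1) * (1 + D powr (\<alpha> * q)))"
    by (simp add: algebra_simps)
  finally have "q * 3 powr (q - 1) * (\<rho> * T powr (q - 1) + D powr \<delta> * z powr (\<alpha> - \<delta>) * T powr (q - 1)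
       + D powr (\<alpha> * q)) \<le> q * 3 powr (q - 1) * (2 * \<rho> * (T powr (q - 1) * (1 + D powr (\<alpha> * q))))"
    using assms by (intro mult_left_mono) auto
  moreover have "q * 3 powr (q - 1) * (2 * \<rho> * (T powr (q - 1) * (1 + D powr (\<alpha> * q))))
      = 2 * q * 3 powr (q - 1) * \<rho> * (T powr (q - 1) * (1 + D powr (\<alpha> * q)))"
    by (simp only: mult_ac)
  moreover have "(max 0 (z - d) powr \<alpha> + s + \<rho>) powr q
        + \<alpha> * z powr (\<alpha> - 1) * T powr (q - 1) * (pos_part d * of_bool (pos_part d \<le> z))
      \<le> T powr q + q * 3 powr (q - 1) * (\<rho> * T powr (q - 1)
          + D powr \<delta> * z powr (\<alpha> - \<delta>) * T powr (q - 1) + D powr (\<alpha> * q))"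
    unfolding T_def D_def using assms by (intro lyapunov_step) auto
  ultimately show ?thesis unfolding D_def by linarith
qed

section \<open>Conditional bounds at a random level\<close>

text \<open>The moment hypothesis holds almost surely for each fixed truncation level, with an exceptional set that
  depends on the level, while the proof truncates at a random level. For a level \<open>N\<close> with countably many
  values that is measurable with respect to \<open>F\<close>, the inequality may be applied on each event
  \<open>{N = k}\<close> separately and summed.\<close>
lemma (in sigma_finite_subalgebra) nn_cond_exp_lower_bound_at_random_level:
  fixes g :: "'a \<Rightarrow> ennreal" and N :: "'a \<Rightarrow> nat" and h :: "nat \<Rightarrow> ennreal"
    and f :: "nat \<Rightarrow> 'a \<Rightarrow> ennreal"
  assumes g: "g \<in> borel_measurable F" and N: "N \<in> F \<rightarrow>\<^sub>M count_space UNIV"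
    and f: "\<And>k. f k \<in> borel_measurable M"
    and bound: "\<And>k. k \<in> R \<Longrightarrow> AE \<omega> in M. h k \<le> nn_cond_exp M F (f k) \<omega>"
    and level: "\<And>\<omega>. \<omega> \<in> space M \<Longrightarrow> g \<omega> \<noteq> 0 \<Longrightarrow> N \<omega> \<in> R"
  shows "(\<integral>\<^sup>+\<omega>. g \<omega> * h (N \<omega>) \<partial>M) \<le> (\<integral>\<^sup>+\<omega>. g \<omega> * f (N \<omega>) \<omega> \<partial>M)"
proof -
  note [measurable] = f
  have [measurable]: "g \<in> borel_measurable M" "N \<in> M \<rightarrow>\<^sub>M count_space UNIV"
    using g N measurable_from_subalg[OF subalg] by auto
  define e where "e k \<omega> = g \<omega> * of_bool (N \<omega> = k)" for k \<omega>
  have eF: "e k \<in> borel_measurable F" for k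
  proof -
    note [measurable] = g N
    show ?thesis unfolding e_def of_bool_def by measurable
  qed
  then have [measurable]: "e k \<in> borel_measurable M" for k
    using measurable_from_subalg[OF subalg] by auto
  have split: "g \<omega> * u (N \<omega>) = (\<Sum>k. e k \<omega> * u k)" for u :: "nat \<Rightarrow> ennreal" and \<omega>
  proof -
    have "(\<Sum>k. e k \<omega> * u k) = (\<Sum>k\<in>{N \<omega>}. e k \<omega> * u k)"
      by (rule suminf_finite) (auto simp: e_def)
    then show ?thesis by (simp add: e_def)
  qed
  have level_k: "(\<integral>\<^sup>+\<omega>. e k \<omega> * h k \<partial>M) \<le> (\<integral>\<^sup>+\<omega>. e k \<omega> * f k \<omega> \<partial>M)" for k
  proof -
    have "(\<integral>\<^sup>+\<omega>. e k \<omega> * h k \<partial>M) \<le> (\<integral>\<^sup>+\<omega>. e k \<omega> * nn_cond_exp M F (f k) \<omega> \<partial>M)"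
    proof (cases "k \<in> R")
      case True
      then show ?thesis
        by (intro nn_integral_mono_AE eventually_mono[OF bound[of k]] mult_left_mono) auto
    next
      case False
      then have "e k \<omega> = 0" if "\<omega> \<in> space M" for \<omega>
        using level[OF that] by (auto simp: e_def)
      then show ?thesis by (intro nn_integral_mono) auto
    qed
    also have "\<dots> = (\<integral>\<^sup>+\<omega>. e k \<omega> * f k \<omega> \<partial>M)"
      using eF by (intro nn_cond_exp_intg) auto
    finally show ?thesis .
  qed
  have split_f: "g \<omega> * f (N \<omega>) \<omega> = (\<Sum>k. e k \<omega> * f k \<omega>)" for \<omega>
    by (rule split)
  have "(\<integral>\<^sup>+\<omega>. g \<omega> * h (N \<omega>) \<partial>M) = (\<Sum>k. \<integral>\<^sup>+\<omega>. e k \<omega> * h k \<partial>M)"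
    unfolding split by (rule nn_integral_suminf) auto
  also have "\<dots> \<le> (\<Sum>k. \<integral>\<^sup>+\<omega>. e k \<omega> * f k \<omega> \<partial>M)"
    by (intro suminf_le level_k) auto
  also have "\<dots> = (\<integral>\<^sup>+\<omega>. g \<omega> * f (N \<omega>) \<omega> \<partial>M)"
    unfolding split_f by (rule nn_integral_suminf[symmetric]) auto
  finally show ?thesis .
qed

section \<open>Processes stopped at first passage\<close>

definition below :: "(nat \<Rightarrow> 'a \<Rightarrow> real) \<Rightarrow> real \<Rightarrow> nat \<Rightarrow> 'a set" where
  "below X x t = {\<omega>. \<forall>s\<le>t. X s \<omega> < x}"

lemma below_Suc_subset: "below X x (Suc t) \<subseteq> below X x t"
  by (auto simp: below_def)

lemma decseq_below: "decseq (below X x)"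
  by (intro decseq_SucI below_Suc_subset)

lemma mem_below_iff: "\<omega> \<in> below X x t \<longleftrightarrow> enat t < first_passage X x \<omega>"
proof (cases "\<exists>s. x \<le> X s \<omega>")
  case True
  define k where "k = (LEAST s. x \<le> X s \<omega>)"
  have k: "x \<le> X k \<omega>" unfolding k_def using True by (rule LeastI_ex)
  have before: "X s \<omega> < x" if "s < k" for s
    using not_less_Least[OF that[unfolded k_def]] by simp
  have "\<omega> \<in> below X x t \<longleftrightarrow> t < k"
  proof
    assume "\<omega> \<in> below X x t"
    then have "\<not> k \<le> t" using k by (auto simp: below_def)
    then show "t < k" by simp
  next
    assume "t < k"
    then show "\<omega> \<in> below X x t" by (simp add: below_def before)
  qed
  then show ?thesis using True by (simp add: first_passage_def k_def)
next
  case False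
  then have "\<forall>s. X s \<omega> < x" by (simp add: not_le)
  with False show ?thesis by (simp add: first_passage_def below_def)
qed

text \<open>For \<open>B n = {\<tau> > n}\<close> this is the stopped process, whose value at time \<open>n\<close> is that of \<open>U\<close> at
  \<open>min n \<tau>\<close>. The recursion avoids evaluating \<open>U\<close> at a random time, so that measurability and the
  supermartingale estimate follow by induction on \<open>n\<close>.\<close>
primrec stopped :: "(nat \<Rightarrow> 'a set) \<Rightarrow> (nat \<Rightarrow> 'a \<Rightarrow> 'b) \<Rightarrow> nat \<Rightarrow> 'a \<Rightarrow> 'b" where
  "stopped B U 0 \<omega> = U 0 \<omega>"
| "stopped B U (Suc n) \<omega> = (if \<omega> \<in> B n then U (Suc n) \<omega> else stopped B U n \<omega>)"

lemma stopped_eq_of_mem: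
  assumes "decseq B" "\<omega> \<in> B n"
  shows "stopped B U n \<omega> = U n \<omega>"
proof (cases n)
  case (Suc m)
  then have "\<omega> \<in> B m" using assms decseq_SucD by blast
  then show ?thesis by (simp add: Suc)
qed simp

lemma stopped_after_first_passage:
  assumes "first_passage X x \<omega> = enat k" "k \<le> n"
  shows "stopped (below X x) U n \<omega> = U k \<omega>"
  using assms(2)
proof (induction n rule: dec_induct)
  case base
  show ?case by (cases k) (auto simp: mem_below_iff assms(1))
qed (simp add: mem_below_iff assms(1))

lemma borel_measurable_stopped:
  assumes [measurable]: "\<And>n. U n \<in> borel_measurable M" "\<And>n. Measurable.pred M (\<lambda>\<omega>. \<omega> \<in> B n)"
  shows "stopped B U n \<in> borel_measurable M"
  by (induction n) simp_all

text \<open>The supermartingale inequality is needed on \<open>B n\<close> only, since the stopped process is frozen off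
  \<open>B n\<close>. Its finiteness premise is supplied by the induction itself.\<close>
lemma nn_integral_stopped_le:
  fixes U :: "nat \<Rightarrow> 'a \<Rightarrow> ennreal"
  assumes U[measurable]: "\<And>n. U n \<in> borel_measurable M"
    and B: "decseq B" and BM[measurable]: "\<And>n. Measurable.pred M (\<lambda>\<omega>. \<omega> \<in> B n)"
    and step: "\<And>n. (\<integral>\<^sup>+\<omega>. U n \<omega> * indicator (B n) \<omega> \<partial>M) < \<infinity> \<Longrightarrow>
      (\<integral>\<^sup>+\<omega>. U (Suc n) \<omega> * indicator (B n) \<omega> \<partial>M) \<le> (\<integral>\<^sup>+\<omega>. U n \<omega> * indicator (B n) \<omega> \<partial>M)"
    and fin: "(\<integral>\<^sup>+\<omega>. U 0 \<omega> \<partial>M) < \<infinity>"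
  shows "(\<integral>\<^sup>+\<omega>. stopped B U n \<omega> \<partial>M) \<le> (\<integral>\<^sup>+\<omega>. U 0 \<omega> \<partial>M)"
proof (induction n)
  case (Suc n)
  have [measurable]: "stopped B U n \<in> borel_measurable M" for n
    by (intro borel_measurable_stopped U BM)
  have [measurable]: "(\<lambda>\<omega>. indicator (B n) \<omega> :: ennreal) \<in> borel_measurable M" for n
    unfolding indicator_def by measurable
  have [measurable]: "(\<lambda>\<omega>. indicator (- B n) \<omega> :: ennreal) \<in> borel_measurable M" for n
    unfolding indicator_def by measurable
  let ?rest = "\<integral>\<^sup>+\<omega>. stopped B U n \<omega> * indicator (- B n) \<omega> \<partial>M"
  have now: "(\<integral>\<^sup>+\<omega>. stopped B U n \<omega> \<partial>M) = (\<integral>\<^sup>+\<omega>. U n \<omega> * indicator (B n) \<omega> \<partial>M) + ?rest"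
    by (subst nn_integral_add[symmetric])
       (auto intro!: nn_integral_cong simp: stopped_eq_of_mem[OF B] split: split_indicator)
  have "(\<integral>\<^sup>+\<omega>. stopped B U n \<omega> \<partial>M) < \<infinity>"
    using Suc fin by (rule le_less_trans)
  then have finite: "(\<integral>\<^sup>+\<omega>. U n \<omega> * indicator (B n) \<omega> \<partial>M) < \<infinity>"
    unfolding now by simp
  have "(\<integral>\<^sup>+\<omega>. stopped B U (Suc n) \<omega> \<partial>M) = (\<integral>\<^sup>+\<omega>. U (Suc n) \<omega> * indicator (B n) \<omega> \<partial>M) + ?rest"
    by (subst nn_integral_add[symmetric])
       (auto intro!: nn_integral_cong split: split_indicator)
  also have "\<dots> \<le> (\<integral>\<^sup>+\<omega>. stopped B U n \<omega> \<partial>M)"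
    unfolding now by (intro add_right_mono step finite)
  finally show ?case using Suc by simp
qed simp

section \<open>Moments of the first passage time from a supermartingale\<close>

lemma enat_powr_le_one_plus:
  assumes "0 \<le> p" "p \<le> q"
  shows "enat_powr n p \<le> 1 + enat_powr n q"
proof (cases n)
  case (enat k)
  show ?thesis
  proof (cases "k = 0")
    case False
    then have "real k powr p \<le> real k powr q"
      using assms by (intro powr_mono) auto
    then have "ennreal (real k powr p) \<le> 1 + ennreal (real k powr q)"
      by (intro order.trans[OF ennreal_leI add_increasing]) auto
    then show ?thesis using assms by (auto simp: enat enat_powr_def)
  qed (use enat in \<open>auto simp: enat_powr_def\<close>)
qed (use assms in \<open>auto simp: enat_powr_def\<close>)

text \<open>If passage occurs at time \<open>k\<close>, the stopped process is eventually constant and equal to \<open>U k\<close>; if it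
  never occurs, the stopped process is \<open>U\<close> itself and diverges by its growth.\<close>
lemma enat_powr_first_passage_le_liminf_stopped:
  assumes q: "0 < q" "0 < \<kappa>"
    and growth: "\<And>n. ennreal ((\<kappa> * real n) powr q) \<le> U n \<omega>"
  shows "enat_powr (first_passage X x \<omega>) q
    \<le> ennreal (\<kappa> powr - q) * liminf (\<lambda>n. stopped (below X x) U n \<omega>)"
proof (cases "first_passage X x \<omega>")
  case (enat k)
  have "enat_powr (first_passage X x \<omega>) q = ennreal (\<kappa> powr - q) * ennreal ((\<kappa> * real k) powr q)"
    using q by (simp add: enat enat_powr_def powr_mult powr_minus flip: ennreal_mult')
  also have "ennreal ((\<kappa> * real k) powr q) \<le> U k \<omega>" by (rule growth)
  also have "U k \<omega> \<le> liminf (\<lambda>n. stopped (below X x) U n \<omega>)"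
    by (intro Liminf_bounded eventually_sequentiallyI[of k])
       (simp add: stopped_after_first_passage[OF enat])
  finally show ?thesis by (simp add: mult_left_mono)
next
  case infinity
  have never: "\<omega> \<in> below X x n" for n
    by (simp add: mem_below_iff infinity)
  have "filterlim (\<lambda>n. (\<kappa> * real n) powr q) at_top sequentially"
    using q by real_asymp
  then have "((\<lambda>n. ennreal ((\<kappa> * real n) powr q)) \<longlongrightarrow> \<infinity>) sequentially"
    unfolding infinity_ennreal_def by (rule ennreal_tendsto_top_eq_at_top[THEN iffD2])
  then have "\<infinity> = liminf (\<lambda>n. ennreal ((\<kappa> * real n) powr q))"
    by (intro lim_imp_Liminf[symmetric]) auto
  also have "\<dots> \<le> liminf (\<lambda>n. stopped (below X x) U n \<omega>)"
    using growth by (intro Liminf_mono) (auto simp: stopped_eq_of_mem[OF decseq_below never])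
  finally show ?thesis using q by (simp add: top_unique ennreal_mult_top)
qed

text \<open>A nonnegative process that is a supermartingale before first passage and dominates
  \<open>(\<kappa> * n) powr q\<close> acts as a certificate for all moments up to order \<open>q\<close>: combine the bound on the
  stopped process with Fatou's lemma.\<close>
lemma (in prob_space) first_passage_moment_finite:
  fixes U :: "nat \<Rightarrow> 'a \<Rightarrow> ennreal"
  assumes q: "0 < q" "0 < \<kappa>" and p: "0 \<le> p" "p \<le> q"
    and U[measurable]: "\<And>n. U n \<in> borel_measurable M"
    and X: "\<And>n. Measurable.pred M (\<lambda>\<omega>. \<omega> \<in> below X x n)"
    and growth: "\<And>n \<omega>. ennreal ((\<kappa> * real n) powr q) \<le> U n \<omega>"
    and step: "\<And>n. (\<integral>\<^sup>+\<omega>. U n \<omega> * indicator (below X x n) \<omega> \<partial>M) < \<infinity> \<Longrightarrow>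
      (\<integral>\<^sup>+\<omega>. U (Suc n) \<omega> * indicator (below X x n) \<omega> \<partial>M)
        \<le> (\<integral>\<^sup>+\<omega>. U n \<omega> * indicator (below X x n) \<omega> \<partial>M)"
    and fin: "(\<integral>\<^sup>+\<omega>. U 0 \<omega> \<partial>M) < \<infinity>"
  shows "(\<integral>\<^sup>+\<omega>. enat_powr (first_passage X x \<omega>) p \<partial>M) < \<infinity>"
proof -
  define V where "V = stopped (below X x) U"
  have VM: "V n \<in> borel_measurable M" for n
    unfolding V_def by (intro borel_measurable_stopped U X)
  have limM: "(\<lambda>\<omega>. liminf (\<lambda>n. V n \<omega>)) \<in> borel_measurable M"
    by (intro borel_measurable_liminf VM)
  have bound: "enat_powr (first_passage X x \<omega>) p
      \<le> 1 + ennreal (\<kappa> powr - q) * liminf (\<lambda>n. V n \<omega>)" for \<omega>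
    using enat_powr_first_passage_le_liminf_stopped[OF q, of U \<omega>, OF growth]
    unfolding V_def by (intro order.trans[OF enat_powr_le_one_plus[OF p]] add_left_mono)
  have "(\<integral>\<^sup>+\<omega>. liminf (\<lambda>n. V n \<omega>) \<partial>M) \<le> liminf (\<lambda>n. \<integral>\<^sup>+\<omega>. V n \<omega> \<partial>M)"
    by (rule nn_integral_liminf[OF VM])
  also have "\<dots> \<le> limsup (\<lambda>n. \<integral>\<^sup>+\<omega>. V n \<omega> \<partial>M)"
    by (rule Liminf_le_Limsup) simp
  also have "\<dots> \<le> (\<integral>\<^sup>+\<omega>. U 0 \<omega> \<partial>M)"
    unfolding V_def
    by (intro Limsup_bounded always_eventually allI nn_integral_stopped_le decseq_below X step fin U)
  finally have lim: "(\<integral>\<^sup>+\<omega>. liminf (\<lambda>n. V n \<omega>) \<partial>M) < \<infinity>"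
    using fin by (rule le_less_trans)
  have "(\<integral>\<^sup>+\<omega>. enat_powr (first_passage X x \<omega>) p \<partial>M)
      \<le> (\<integral>\<^sup>+\<omega>. 1 + ennreal (\<kappa> powr - q) * liminf (\<lambda>n. V n \<omega>) \<partial>M)"
    by (rule nn_integral_mono) (rule bound)
  also have "\<dots> = 1 + ennreal (\<kappa> powr - q) * (\<integral>\<^sup>+\<omega>. liminf (\<lambda>n. V n \<omega>) \<partial>M)"
    using limM by (simp add: nn_integral_add nn_integral_cmult emeasure_space_1)
  also have "\<dots> < \<infinity>"
    using lim by (simp add: ennreal_mult_less_top)
  finally show ?thesis .
qed

section \<open>The supermartingale property\<close>

text \<open>One step of the supermartingale estimate, on an event \<open>B\<close> of the past on which the distance
  \<open>Y\<close> to the shifted level is at least \<open>A\<close>. With the weight \<open>w = T powr (q - 1)\<close>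
  on \<open>B\<close>, and up to the common factor \<open>\<integral>\<^sup>+\<omega>. w \<omega> \<partial>M\<close>, the expected gain is at least \<open>\<alpha> * c / 2\<close> and
  the expected loss at most \<open>2 * q * 3 powr (q - 1) * \<rho> * (1 + C)\<close>, so the premise \<open>balance\<close> closes the
  argument. Gain and loss are kept on opposite sides, because nonnegative integrals cannot be
  subtracted; \<open>T \<ge> 1\<close> makes the integral of \<open>w\<close> finite, which permits the final cancellation.\<close>
lemma (in sigma_finite_subalgebra) lyapunov_integral_step:
  fixes Y \<Delta> :: "'a \<Rightarrow> real" and B :: "'a set"
  assumes \<alpha>: "0 < \<alpha>" "\<alpha> < 1" and q: "1 < q" and \<delta>: "\<alpha> \<le> \<delta>" "\<delta> \<le> 1" "\<delta> \<le> \<alpha> * q"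
    and \<rho>: "0 \<le> \<rho>" "\<rho> \<le> 1" and nonneg: "0 \<le> s" "0 \<le> c" "0 \<le> C" "0 \<le> x\<^sub>0"
    and A: "x\<^sub>0 + 1 \<le> A" "A powr (\<alpha> - \<delta>) \<le> \<rho>" "A powr (- (\<alpha> * (q - 1))) \<le> \<rho>"
    and balance: "2 * q * 3 powr (q - 1) * \<rho> * (1 + C) \<le> \<alpha> * c / 2"
    and Y: "Y \<in> borel_measurable F" and \<Delta>: "\<Delta> \<in> borel_measurable M"
    and B: "Measurable.pred F (\<lambda>\<omega>. \<omega> \<in> B)"
    and far: "\<And>\<omega>. \<omega> \<in> B \<Longrightarrow> A \<le> Y \<omega>"
    and down: "AE \<omega> in M. nn_cond_exp M F (\<lambda>\<omega>. ennreal (neg_part (\<Delta> \<omega>) powr (\<alpha> * q))) \<omega> \<le> ennreal C"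
    and up: "\<And>y. x\<^sub>0 \<le> y \<Longrightarrow> AE \<omega> in M. ennreal (c * y powr (1 - \<alpha>))
        \<le> nn_cond_exp M F (\<lambda>\<omega>. ennreal (pos_part (\<Delta> \<omega>) * of_bool (pos_part (\<Delta> \<omega>) \<le> y))) \<omega>"
    and fin: "(\<integral>\<^sup>+\<omega>. ennreal ((Y \<omega> powr \<alpha> + s) powr q) * indicator B \<omega> \<partial>M) < \<infinity>"
  shows "(\<integral>\<^sup>+\<omega>. ennreal ((max 0 (Y \<omega> - \<Delta> \<omega>) powr \<alpha> + s + \<rho>) powr q) * indicator B \<omega> \<partial>M)
      \<le> (\<integral>\<^sup>+\<omega>. ennreal ((Y \<omega> powr \<alpha> + s) powr q) * indicator B \<omega> \<partial>M)"
proof -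
  note [measurable] = \<Delta>
  have [measurable]: "Y \<in> borel_measurable M"
    using Y by (rule measurable_from_subalg[OF subalg])
  have [measurable]: "Measurable.pred M (\<lambda>\<omega>. \<omega> \<in> B)"
    using B by (rule measurable_from_subalg[OF subalg])
  have [measurable]: "(\<lambda>\<omega>. indicator B \<omega> :: ennreal) \<in> borel_measurable M"
    unfolding indicator_def by measurable
  have [measurable]: "(\<lambda>\<omega>. neg_part (\<Delta> \<omega>)) \<in> borel_measurable M"
    "(\<lambda>\<omega>. pos_part (\<Delta> \<omega>)) \<in> borel_measurable M"
    unfolding neg_part_def pos_part_def by measurable
  define L where "L = 2 * q * 3 powr (q - 1) * \<rho>"
  have L: "0 \<le> L" using q \<rho> by (simp add: L_def)
  define T where "T \<omega> = Y \<omega> powr \<alpha> + s" for \<omega>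
  define w where "w \<omega> = ennreal (T \<omega> powr (q - 1)) * indicator B \<omega>" for \<omega>
  define v where "v \<omega> = w \<omega> * ennreal (\<alpha> * Y \<omega> powr (\<alpha> - 1))" for \<omega>
  \<comment> \<open>The truncation level \<open>Y\<close> is rounded down to an integer to have countably many values; as \<open>Y \<ge> 1\<close>,
    this costs at most a factor 2 in the drift.\<close>
  define N where "N \<omega> = nat \<lfloor>Y \<omega>\<rfloor>" for \<omega>
  define f where "f k \<omega> = ennreal (pos_part (\<Delta> \<omega>) * of_bool (pos_part (\<Delta> \<omega>) \<le> real k))" for k \<omega>
  define D where "D \<omega> = ennreal (neg_part (\<Delta> \<omega>) powr (\<alpha> * q))" for \<omega>
  have wF: "w \<in> borel_measurable F" and vF: "v \<in> borel_measurable F"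
    and NF: "N \<in> F \<rightarrow>\<^sub>M count_space UNIV"
  proof -
    note [measurable] = Y B
    have [measurable]: "(\<lambda>\<omega>. indicator B \<omega> :: ennreal) \<in> borel_measurable F"
      unfolding indicator_def by measurable
    show [measurable]: "w \<in> borel_measurable F" unfolding w_def T_def by measurable
    show "v \<in> borel_measurable F" unfolding v_def by measurable
    show "N \<in> F \<rightarrow>\<^sub>M count_space UNIV" unfolding N_def by measurable
  qed
  have [measurable]: "w \<in> borel_measurable M" "v \<in> borel_measurable M"
    "N \<in> M \<rightarrow>\<^sub>M count_space UNIV"
    using wF vF NF measurable_from_subalg[OF subalg] by auto
  have fM[measurable]: "f k \<in> borel_measurable M" for k
    unfolding f_def of_bool_def by measurable
  have [measurable]: "(\<lambda>\<omega>. f (N \<omega>) \<omega>) \<in> borel_measurable M"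
    unfolding f_def of_bool_def by measurable
  have [measurable]: "D \<in> borel_measurable M"
    unfolding D_def by measurable

  let ?W = "\<integral>\<^sup>+\<omega>. w \<omega> \<partial>M"
  have Y1: "1 \<le> Y \<omega>" "A \<le> Y \<omega>" "1 \<le> T \<omega>" if "\<omega> \<in> B" for \<omega>
  proof -
    show "1 \<le> Y \<omega>" "A \<le> Y \<omega>" using far[OF that] A nonneg by auto
    then show "1 \<le> T \<omega>"
      using \<alpha> nonneg by (simp add: T_def add_increasing2 ge_one_powr_ge_zero)
  qed
  have "?W \<le> (\<integral>\<^sup>+\<omega>. ennreal (T \<omega> powr q) * indicator B \<omega> \<partial>M)"
    using q Y1 by (intro nn_integral_mono)
      (auto simp: w_def split: split_indicator intro!: powr_mono ennreal_leI)
  with fin have W_fin: "?W < \<infinity>" unfolding T_def by (rule le_less_trans[rotated])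

  have down_le: "(\<integral>\<^sup>+\<omega>. w \<omega> * D \<omega> \<partial>M) \<le> ennreal C * ?W"
  proof -
    have "(\<integral>\<^sup>+\<omega>. w \<omega> * D \<omega> \<partial>M) = (\<integral>\<^sup>+\<omega>. w \<omega> * nn_cond_exp M F D \<omega> \<partial>M)"
      using wF by (intro nn_cond_exp_intg[symmetric]) auto
    also have "\<dots> \<le> (\<integral>\<^sup>+\<omega>. w \<omega> * ennreal C \<partial>M)"
      using down unfolding D_def[abs_def]
      by (intro nn_integral_mono_AE eventually_mono[OF _ mult_left_mono]) auto
    also have "\<dots> = ennreal C * ?W"
      by (subst nn_integral_multc) (simp_all add: mult.commute)
    finally show ?thesis .
  qed

  have up_ge: "ennreal (\<alpha> * c / 2) * ?W \<le> (\<integral>\<^sup>+\<omega>. v \<omega> * f (N \<omega>) \<omega> \<partial>M)"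
  proof -
    have "w \<omega> * ennreal (\<alpha> * c / 2) \<le> v \<omega> * ennreal (c * real (N \<omega>) powr (1 - \<alpha>))" for \<omega>
    proof (cases "\<omega> \<in> B")
      case True
      have n: "1 \<le> Y \<omega>" "Y \<omega> / 2 \<le> real (N \<omega>)" "0 < real (N \<omega>)"
      proof -
        show "1 \<le> Y \<omega>" by (rule Y1(1)[OF True])
        then have "real (N \<omega>) = real_of_int \<lfloor>Y \<omega>\<rfloor>" "(1::real) \<le> real_of_int \<lfloor>Y \<omega>\<rfloor>"
          by (simp_all add: N_def)
        then show "Y \<omega> / 2 \<le> real (N \<omega>)" "0 < real (N \<omega>)"
          using real_of_int_floor_add_one_gt[of "Y \<omega>"] by linarith+
      qed
      have "1/2 \<le> real (N \<omega>) / Y \<omega>" "real (N \<omega>) / Y \<omega> \<le> 1"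
        using n by (simp_all add: field_simps N_def)
      moreover from this have "real (N \<omega>) / Y \<omega> \<le> (real (N \<omega>) / Y \<omega>) powr (1 - \<alpha>)"
        using powr_mono'[of "1 - \<alpha>" 1 "real (N \<omega>) / Y \<omega>"] \<alpha> n by simp
      ultimately have "1/2 \<le> (real (N \<omega>) / Y \<omega>) powr (1 - \<alpha>)"
        by linarith
      also have "\<dots> = Y \<omega> powr (\<alpha> - 1) * real (N \<omega>) powr (1 - \<alpha>)"
        using n by (simp add: powr_divide powr_diff field_simps)
      finally have "\<alpha> * c * (1/2) \<le> \<alpha> * c * (Y \<omega> powr (\<alpha> - 1) * real (N \<omega>) powr (1 - \<alpha>))"
        using \<alpha> nonneg by (intro mult_left_mono) auto
      then have "\<alpha> * c / 2 \<le> (\<alpha> * Y \<omega> powr (\<alpha> - 1)) * (c * real (N \<omega>) powr (1 - \<alpha>))"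
        by (simp add: mult_ac)
      then show ?thesis
        unfolding v_def mult.assoc using \<alpha> nonneg
        by (intro mult_left_mono) (simp_all add: ennreal_leI flip: ennreal_mult)
    qed (simp add: w_def)
    then have "ennreal (\<alpha> * c / 2) * ?W \<le> (\<integral>\<^sup>+\<omega>. v \<omega> * ennreal (c * real (N \<omega>) powr (1 - \<alpha>)) \<partial>M)"
      by (subst nn_integral_cmult[symmetric]) (auto intro!: nn_integral_mono simp: mult.commute)
    also have "\<dots> \<le> (\<integral>\<^sup>+\<omega>. v \<omega> * f (N \<omega>) \<omega> \<partial>M)"
    proof (rule nn_cond_exp_lower_bound_at_random_level[OF vF NF fM,
          where h = "\<lambda>k. ennreal (c * real k powr (1 - \<alpha>))" and R = "{k. x\<^sub>0 \<le> real k}"])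
      show "AE \<omega> in M. ennreal (c * real k powr (1 - \<alpha>)) \<le> nn_cond_exp M F (f k) \<omega>"
        if "k \<in> {k. x\<^sub>0 \<le> real k}" for k
        using up[of "real k"] that unfolding f_def[abs_def] by simp
      \<comment> \<open>The margin 1 in \<open>x\<^sub>0 + 1 \<le> A\<close> absorbs the rounding.\<close>
      show "N \<omega> \<in> {k. x\<^sub>0 \<le> real k}" if "\<omega> \<in> space M" "v \<omega> \<noteq> 0" for \<omega>
      proof -
        have "\<omega> \<in> B" using that by (auto simp: v_def w_def split: split_indicator_asm)
        then have "x\<^sub>0 + 1 \<le> Y \<omega>" using Y1 A by force
        then have "x\<^sub>0 \<le> real_of_int \<lfloor>Y \<omega>\<rfloor>"
          using real_of_int_floor_add_one_gt[of "Y \<omega>"] by linarith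
        then show ?thesis
          using of_nat_nat[of "\<lfloor>Y \<omega>\<rfloor>"] nonneg by (simp add: N_def)
      qed
    qed
    finally show ?thesis .
  qed

  have pointwise: "ennreal ((max 0 (Y \<omega> - \<Delta> \<omega>) powr \<alpha> + s + \<rho>) powr q) * indicator B \<omega> + v \<omega> * f (N \<omega>) \<omega>
      \<le> ennreal (T \<omega> powr q) * indicator B \<omega> + ennreal L * (w \<omega> + w \<omega> * D \<omega>)" for \<omega>
  proof (cases "\<omega> \<in> B")
    case True
    have p0: "0 \<le> pos_part (\<Delta> \<omega>)" by (simp add: pos_part_def)
    have NY: "real (N \<omega>) \<le> Y \<omega>" using Y1(1)[OF True] by (simp add: N_def)
    have "(max 0 (Y \<omega> - \<Delta> \<omega>) powr \<alpha> + s + \<rho>) powr q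
        + \<alpha> * Y \<omega> powr (\<alpha> - 1) * T \<omega> powr (q - 1)
          * (pos_part (\<Delta> \<omega>) * of_bool (pos_part (\<Delta> \<omega>) \<le> real (N \<omega>)))
      \<le> (max 0 (Y \<omega> - \<Delta> \<omega>) powr \<alpha> + s + \<rho>) powr q
        + \<alpha> * Y \<omega> powr (\<alpha> - 1) * T \<omega> powr (q - 1)
          * (pos_part (\<Delta> \<omega>) * of_bool (pos_part (\<Delta> \<omega>) \<le> Y \<omega>))"
      using p0 \<alpha> NY by (intro add_left_mono mult_left_mono) auto
    also have "\<dots> \<le> T \<omega> powr q + L * (T \<omega> powr (q - 1) * (1 + neg_part (\<Delta> \<omega>) powr (\<alpha> * q)))"
      using lyapunov_step_uniform[of \<alpha> q \<delta> A "Y \<omega>" s \<rho> "\<Delta> \<omega>"] \<alpha> q \<delta> \<rho> A nonneg Y1[OF True]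
      unfolding T_def L_def by simp
    finally have "ennreal ((max 0 (Y \<omega> - \<Delta> \<omega>) powr \<alpha> + s + \<rho>) powr q
        + \<alpha> * Y \<omega> powr (\<alpha> - 1) * T \<omega> powr (q - 1)
          * (pos_part (\<Delta> \<omega>) * of_bool (pos_part (\<Delta> \<omega>) \<le> real (N \<omega>))))
      \<le> ennreal (T \<omega> powr q + L * (T \<omega> powr (q - 1) * (1 + neg_part (\<Delta> \<omega>) powr (\<alpha> * q))))"
      by (rule ennreal_leI)
    moreover have "v \<omega> * f (N \<omega>) \<omega> = ennreal (\<alpha> * Y \<omega> powr (\<alpha> - 1) * T \<omega> powr (q - 1)
          * (pos_part (\<Delta> \<omega>) * of_bool (pos_part (\<Delta> \<omega>) \<le> real (N \<omega>))))"
      using True \<alpha> p0 by (simp add: v_def w_def f_def mult_ac flip: ennreal_mult)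
    moreover have "ennreal L * (w \<omega> + w \<omega> * D \<omega>)
        = ennreal (L * (T \<omega> powr (q - 1) * (1 + neg_part (\<Delta> \<omega>) powr (\<alpha> * q))))"
      using True L by (simp add: w_def D_def distrib_left flip: ennreal_mult ennreal_plus)
    ultimately show ?thesis
      using True \<alpha> p0 L by (simp add: ennreal_plus)
  qed (simp add: v_def w_def)

  let ?next = "\<integral>\<^sup>+\<omega>. ennreal ((max 0 (Y \<omega> - \<Delta> \<omega>) powr \<alpha> + s + \<rho>) powr q) * indicator B \<omega> \<partial>M"
  let ?now = "\<integral>\<^sup>+\<omega>. ennreal (T \<omega> powr q) * indicator B \<omega> \<partial>M"
  have "?next + ennreal (\<alpha> * c / 2) * ?W \<le> ?next + (\<integral>\<^sup>+\<omega>. v \<omega> * f (N \<omega>) \<omega> \<partial>M)"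
    by (intro add_left_mono up_ge)
  also have "\<dots> = (\<integral>\<^sup>+\<omega>. ennreal ((max 0 (Y \<omega> - \<Delta> \<omega>) powr \<alpha> + s + \<rho>) powr q) * indicator B \<omega>
      + v \<omega> * f (N \<omega>) \<omega> \<partial>M)"
    by (rule nn_integral_add[symmetric]) measurable
  also have "\<dots> \<le> (\<integral>\<^sup>+\<omega>. ennreal (T \<omega> powr q) * indicator B \<omega> + ennreal L * (w \<omega> + w \<omega> * D \<omega>) \<partial>M)"
    by (intro nn_integral_mono pointwise)
  also have "\<dots> = ?now + ennreal L * (?W + (\<integral>\<^sup>+\<omega>. w \<omega> * D \<omega> \<partial>M))"
    unfolding T_def by (simp add: nn_integral_add nn_integral_cmult)
  also have "\<dots> \<le> ?now + ennreal L * (?W + ennreal C * ?W)"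
    by (intro add_left_mono mult_left_mono down_le) auto
  also have "\<dots> = ?now + ennreal (L * (1 + C)) * ?W"
    using L nonneg by (simp add: ennreal_mult ennreal_plus distrib_left distrib_right mult.assoc)
  also have "\<dots> \<le> ?now + ennreal (\<alpha> * c / 2) * ?W"
    using balance by (intro add_left_mono mult_right_mono ennreal_leI) (auto simp: L_def)
  finally have "ennreal (\<alpha> * c / 2) * ?W + ?next \<le> ennreal (\<alpha> * c / 2) * ?W + ?now"
    by (simp add: add.commute)
  moreover have "ennreal (\<alpha> * c / 2) * ?W < \<infinity>"
    using W_fin by (simp add: ennreal_mult_less_top)
  ultimately have "?next \<le> ?now"
    by (auto simp: ennreal_add_left_cancel_le)
  then show ?thesis by (simp add: T_def)
qed

section \<open>Moments of the first passage time under heavy-tailed increments\<close>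

text \<open>The moments are finite up to and including the critical order. The rate \<open>\<rho>\<close> is fixed first, so that
  losses are at most half of the drift. Then \<open>A\<close> is chosen large enough to make the two negative powers in
  \<open>lyapunov_step_uniform\<close> at most \<open>\<rho>\<close>.\<close>
lemma first_passage_moment_finite_upto_critical:
  fixes M :: "'a measure" and F :: "nat \<Rightarrow> 'a measure" and X :: "nat \<Rightarrow> 'a \<Rightarrow> real"
    and \<alpha> \<beta> c C x\<^sub>0 x p :: real
  assumes "prob_space M"
    and adapted: "adapted_process M F X"
    and start: "\<forall>\<omega>\<in>space M. X 0 \<omega> = 0"
    and \<alpha>: "0 < \<alpha>" "\<alpha> < 1" "\<alpha> < \<beta>"
    and c: "0 < c" "0 < x\<^sub>0"
    and down: "\<And>t. AE \<omega> in M.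
           nn_cond_exp M (F t) (\<lambda>\<omega>. ennreal (neg_part (increment X t \<omega>) powr \<beta>)) \<omega> \<le> ennreal C"
    and up: "\<And>y t. x\<^sub>0 \<le> y \<Longrightarrow> AE \<omega> in M.
           ennreal (c * y powr (1 - \<alpha>))
             \<le> nn_cond_exp M (F t)
                 (\<lambda>\<omega>. ennreal (pos_part (increment X t \<omega>)
                        * of_bool (pos_part (increment X t \<omega>) \<le> y))) \<omega>"
    and p: "0 \<le> p" "p \<le> \<beta> / \<alpha>"
  shows "(\<integral>\<^sup>+\<omega>. enat_powr (first_passage X x \<omega>) p \<partial>M) < \<infinity>"
proof -
  interpret prob_space M by fact
  have sub: "subalgebra M (F t)" and XF: "X t \<in> borel_measurable (F t)" for t
    using adapted by (auto simp: adapted_process_def)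
  interpret filtration "space M" F
    using adapted by (simp add: adapted_process_def)
  have [measurable]: "X t \<in> borel_measurable M" for t
    using XF by (rule measurable_from_subalg[OF sub])
  have XF': "X s \<in> borel_measurable (F t)" if "s \<le> t" for s t
    by (rule borel_measurable_subalgebra[OF sets_F_mono[OF that] _ XF]) (simp add: space_F)
  have below_F: "Measurable.pred (F t) (\<lambda>\<omega>. \<omega> \<in> below X x t)" for t
  proof -
    have [measurable]: "X s \<in> borel_measurable (F t)" if "s \<in> {..t}" for s
      using that by (intro XF') auto
    have "Measurable.pred (F t) (\<lambda>\<omega>. \<forall>s\<in>{..t}. X s \<omega> < x)" by measurable
    then show ?thesis by (simp add: below_def)
  qed

  define q where "q = \<beta> / \<alpha>"
  define \<delta> where "\<delta> = min \<beta> 1"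
  \<comment> \<open>A negative \<open>C\<close> means the same as 0 under \<open>ennreal\<close>, hence \<open>max C 0\<close>.\<close>
  define K where "K = 2 * q * 3 powr (q - 1) * (1 + max C 0)"
  define \<rho> where "\<rho> = min 1 (\<alpha> * c / (2 * K))"
  have q: "1 < q" "\<alpha> * q = \<beta>" using \<alpha> by (auto simp: q_def)
  have \<delta>: "\<alpha> < \<delta>" "\<delta> \<le> 1" "\<delta> \<le> \<beta>" using \<alpha> by (auto simp: \<delta>_def)
  have K: "0 < K" using q by (auto simp: K_def intro!: mult_pos_pos)
  have \<rho>: "0 < \<rho>" "\<rho> \<le> 1" using \<alpha> c K by (auto simp: \<rho>_def)
  have "\<rho> * K \<le> \<alpha> * c / (2 * K) * K"
    using K by (intro mult_right_mono) (auto simp: \<rho>_def)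
  also have "\<dots> = \<alpha> * c / 2" using K by simp
  finally have balance: "2 * q * 3 powr (q - 1) * \<rho> * (1 + max C 0) \<le> \<alpha> * c / 2"
    by (simp only: K_def mult_ac)
  have small: "eventually (\<lambda>A::real. A powr - e \<le> \<rho>) at_top" if "0 < e" for e
  proof -
    have "((\<lambda>A::real. A powr - e) \<longlongrightarrow> 0) at_top"
      using that by (intro tendsto_neg_powr filterlim_ident) auto
    from order_tendstoD(2)[OF this \<rho>(1)] show ?thesis
      by (rule eventually_mono) simp
  qed
  have "eventually (\<lambda>A::real. A powr (\<alpha> - \<delta>) \<le> \<rho> \<and> A powr - (\<alpha> * (q - 1)) \<le> \<rho> \<and> x\<^sub>0 + 1 \<le> A) at_top"
    using small[of "\<delta> - \<alpha>"] small[of "\<alpha> * (q - 1)"] eventually_ge_at_top[of "x\<^sub>0 + 1"] \<alpha> \<delta> q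
    by (auto simp: eventually_conj_iff)
  then obtain A where A: "A powr (\<alpha> - \<delta>) \<le> \<rho>" "A powr - (\<alpha> * (q - 1)) \<le> \<rho>" "x\<^sub>0 + 1 \<le> A"
    using eventually_happens' trivial_limit_at_top_linorder by blast

  \<comment> \<open>Before passage \<open>X t < x\<close>, so the distance to \<open>x + A\<close> exceeds \<open>A\<close>; the clipping at 0 can
    act from passage on only.\<close>
  define U where "U t \<omega> = ennreal ((max 0 (x + A - X t \<omega>) powr \<alpha> + \<rho> * real t) powr q)" for t \<omega>
  show ?thesis
  proof (rule first_passage_moment_finite[where U = U and \<kappa> = \<rho> and q = q])
    show "0 < q" "0 < \<rho>" "0 \<le> p" "p \<le> q" using q \<rho> p by (auto simp: q_def)
    show "U n \<in> borel_measurable M" for n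
      unfolding U_def by measurable
    show "Measurable.pred M (\<lambda>\<omega>. \<omega> \<in> below X x n)" for n
      using below_F by (rule measurable_from_subalg[OF sub])
    show "ennreal ((\<rho> * real n) powr q) \<le> U n \<omega>" for n \<omega>
      unfolding U_def using \<rho> q by (intro ennreal_leI powr_mono2) auto
    have "(\<integral>\<^sup>+\<omega>. U 0 \<omega> \<partial>M) = (\<integral>\<^sup>+\<omega>. ennreal ((max 0 (x + A) powr \<alpha>) powr q) \<partial>M)"
      using start by (intro nn_integral_cong) (simp add: U_def)
    also have "\<dots> < \<infinity>" by (simp add: emeasure_space_1)
    finally show "(\<integral>\<^sup>+\<omega>. U 0 \<omega> \<partial>M) < \<infinity>" .
  next
    fix n
    assume fin: "(\<integral>\<^sup>+\<omega>. U n \<omega> * indicator (below X x n) \<omega> \<partial>M) < \<infinity>"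
    interpret finite_measure_subalgebra M "F n"
      by unfold_locales (rule sub)
    define Y where "Y \<omega> = x + A - X n \<omega>" for \<omega>
    have far: "A \<le> Y \<omega>" if "\<omega> \<in> below X x n" for \<omega>
    proof -
      have "X n \<omega> < x" using that by (simp add: below_def)
      then show ?thesis by (simp add: Y_def)
    qed
    have now: "U n \<omega> * indicator (below X x n) \<omega>
        = ennreal ((Y \<omega> powr \<alpha> + \<rho> * real n) powr q) * indicator (below X x n) \<omega>" for \<omega>
    proof (cases "\<omega> \<in> below X x n")
      case True
      then have "max 0 (x + A - X n \<omega>) = Y \<omega>"
        using far[of \<omega>] A c by (simp add: Y_def)
      then show ?thesis by (simp add: U_def)
    qed simp
    have "next": "U (Suc n) \<omega> = ennreal ((max 0 (Y \<omega> - increment X n \<omega>) powr \<alpha> + \<rho> * real n + \<rho>) powr q)" for \<omega>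
      by (simp add: U_def Y_def increment_def algebra_simps)
    show "(\<integral>\<^sup>+\<omega>. U (Suc n) \<omega> * indicator (below X x n) \<omega> \<partial>M)
        \<le> (\<integral>\<^sup>+\<omega>. U n \<omega> * indicator (below X x n) \<omega> \<partial>M)"
      unfolding now "next"
    proof (rule lyapunov_integral_step[where \<delta> = \<delta> and A = A and c = c and C = "max C 0" and x\<^sub>0 = x\<^sub>0])
      show "Y \<in> borel_measurable (F n)"
        using XF[of n] unfolding Y_def by measurable
      show "increment X n \<in> borel_measurable M"
        unfolding increment_def[abs_def] by measurable
      show "(\<integral>\<^sup>+\<omega>. ennreal ((Y \<omega> powr \<alpha> + \<rho> * real n) powr q) * indicator (below X x n) \<omega> \<partial>M) < \<infinity>"
        using fin unfolding now .
      show "AE \<omega> in M. nn_cond_exp M (F n) (\<lambda>\<omega>. ennreal (neg_part (increment X n \<omega>) powr (\<alpha> * q))) \<omega>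
          \<le> ennreal (max C 0)"
      proof -
        have "ennreal (max C 0) = ennreal C" by (simp add: max_def ennreal_neg)
        then show ?thesis using down[of n] by (simp add: q)
      qed
    qed (use \<alpha> q \<delta> \<rho> c A balance below_F far up in auto)
  qed
qed

theorem theorem2p4:
  fixes M :: "'a measure" and F :: "nat \<Rightarrow> 'a measure" and X :: "nat \<Rightarrow> 'a \<Rightarrow> real"
    and \<alpha> \<beta> c C x\<^sub>0 x p :: real
  assumes "prob_space M"
    and "adapted_process M F X"
    and "\<forall>\<omega>\<in>space M. X 0 \<omega> = 0"
    and "0 < \<alpha>" and "\<alpha> < 1" and "\<alpha> < \<beta>"
    and "0 < c" and "0 < x\<^sub>0"
    and "\<And>t. AE \<omega> in M.
           nn_cond_exp M (F t) (\<lambda>\<omega>. ennreal (neg_part (increment X t \<omega>) powr \<beta>)) \<omega> \<le> ennreal C"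
    and "\<And>y t. x\<^sub>0 \<le> y \<Longrightarrow> AE \<omega> in M.
           ennreal (c * y powr (1 - \<alpha>))
             \<le> nn_cond_exp M (F t)
                 (\<lambda>\<omega>. ennreal (pos_part (increment X t \<omega>)
                        * of_bool (pos_part (increment X t \<omega>) \<le> y))) \<omega>"
    and "0 \<le> p" and "p < \<beta> / \<alpha>"
  shows "(\<integral>\<^sup>+\<omega>. enat_powr (first_passage X x \<omega>) p \<partial>M) < \<infinity>"
  by (rule first_passage_moment_finite_upto_critical[OF assms(1-11) less_imp_le[OF assms(12)]])

end
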